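(* For every integer $n \geq 3$, $\gamma_{b,2}(P_4 \square C_n) = 8\left\lfloor \frac{n}{10} \right\rfloor + c(n_{10})$, where $n_{10} \in \{0,1,\dots,9\}$ is the least residue of $n$ modulo $10$ and $c(0)=0$, $c(1)=2$, $c(2)=2$, $c(3)=3$, $c(4)=4$, $c(5)=5$, $c(6)=5$, $c(7)=6$, $c(8)=7$, $c(9)=8$.
   Context: For a graph $G$, a $2$-limited broadcast is a function $f: V(G) \to \{0,1,2\}$. A vertex $u$ hears the broadcast from $v$ if $f(v) > 0$ and $d(u,v) \leq f(v)$, where $d$ is the distance in $G$. The broadcast $f$ is dominating if every vertex of $G$ hears the broadcast from some vertex. The cost of $f$ is $\sum_{v \in V(G)} f(v)$. The $2$-limited broadcast domination number $\gamma_{b,2}(G)$ is the minimum cost of a $2$-limited dominating broadcast on $G$. $C_n$ denotes the cycle on $n$ vertices, $P_4$ the path on $4$ vertices, and $\square$ the Cartesian product of graphs. *)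

theory Defs
  imports Main "HOL-Library.Extended_Nat"
begin

text \<open>A (simple, undirected) graph is given by its vertex set and a symmetric
  edge relation on it.\<close>
type_synonym 'a graph = "'a set \<times> ('a \<times> 'a) set"

definition verts :: "'a graph \<Rightarrow> 'a set" where "verts G = fst G"
definition edges :: "'a graph \<Rightarrow> ('a \<times> 'a) set" where "edges G = snd G"

text \<open>Graph distance: length of a shortest walk (infinity if none).\<close>
definition gdist :: "'a graph \<Rightarrow> 'a \<Rightarrow> 'a \<Rightarrow> enat" where
  "gdist G u v = (INF k \<in> {k::nat. (u, v) \<in> (edges G) ^^ k}. enat k)"

definition path_graph :: "nat \<Rightarrow> nat graph" where
  "path_graph m = ({0..<m}, {(i, j). i < m \<and> j < m \<and> (j = i + 1 \<or> i = j + 1)})"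

definition cycle_graph :: "nat \<Rightarrow> nat graph" where
  "cycle_graph n = ({0..<n}, {(i, j). i < n \<and> j < n \<and> (j = (i + 1) mod n \<or> i = (j + 1) mod n)})"

definition cart_prod :: "'a graph \<Rightarrow> 'b graph \<Rightarrow> ('a \<times> 'b) graph" where
  "cart_prod G H = (verts G \<times> verts H,
     {((a, b), (c, d)). ((a, c) \<in> edges G \<and> b = d \<and> b \<in> verts H)
                     \<or> (a = c \<and> a \<in> verts G \<and> (b, d) \<in> edges H)})"

definition limited_broadcast2 :: "'a graph \<Rightarrow> ('a \<Rightarrow> nat) \<Rightarrow> bool" where
  "limited_broadcast2 G f \<longleftrightarrow> (\<forall>v \<in> verts G. f v \<le> 2) \<and> (\<forall>v. v \<notin> verts G \<longrightarrow> f v = 0)"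

definition hears :: "'a graph \<Rightarrow> ('a \<Rightarrow> nat) \<Rightarrow> 'a \<Rightarrow> 'a \<Rightarrow> bool" where
  "hears G f u v \<longleftrightarrow> f v > 0 \<and> gdist G u v \<le> enat (f v)"

definition dominating_broadcast :: "'a graph \<Rightarrow> ('a \<Rightarrow> nat) \<Rightarrow> bool" where
  "dominating_broadcast G f \<longleftrightarrow> (\<forall>u \<in> verts G. \<exists>v \<in> verts G. hears G f u v)"

definition broadcast_cost :: "'a graph \<Rightarrow> ('a \<Rightarrow> nat) \<Rightarrow> nat" where
  "broadcast_cost G f = (\<Sum>v \<in> verts G. f v)"

definition gamma_b2 :: "'a graph \<Rightarrow> nat" where
  "gamma_b2 G = (LEAST c. \<exists>f. limited_broadcast2 G f \<and> dominating_broadcast G f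
                              \<and> broadcast_cost G f = c)"

definition c_tab :: "nat \<Rightarrow> nat" where
  "c_tab r = [0, 2, 2, 3, 4, 5, 5, 6, 7, 8] ! r"

end

theory Submission
  imports Defs
begin

text \<open>
  Lower bound: in \<open>P\<^sub>4 \<box> C\<^sub>n\<close> give weight 3 to the vertices of the two outer rows and weight 1 to
  those of the two inner rows. A vertex broadcasting with strength \<open>s\<close> reaches vertices of total
  weight at most \<open>10 s\<close>, while the whole graph has weight \<open>8 n\<close>; hence the cost is at least
  \<open>\<lceil>4 n / 5\<rceil>\<close>. The claimed value exceeds this only for \<open>n \<equiv> 1, 5 (mod 10)\<close>. There a
  cheaper broadcast would have total slack at most 2 in the weighted count, and comparing the
  coverage of the four rows separately rules this out by integrality.

  Upper bound: blocks of columns that begin with a strength 2 vertex in the second row and are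
  dominated by themselves together with the first column of the following block can be strung
  together in any order. Blocks of lengths 1, 3, 4, 5, 6, 7, 8 and 10 with costs 2, 3, 4, 5, 5, 6, 7
  and 8 suffice.
\<close>

section \<open>Walks in the product of a path and a cycle\<close>

text \<open>If no walk has length at most \<open>m\<close>, then \<open>m + 1\<close> is a lower
  bound of the infimum, even when there is no walk at all.\<close>

lemma gdist_le_enat_iff: "gdist G u v \<le> enat m \<longleftrightarrow> (\<exists>k\<le>m. (u, v) \<in> edges G ^^ k)"
proof
  assume le: "gdist G u v \<le> enat m"
  show "\<exists>k\<le>m. (u, v) \<in> edges G ^^ k"
  proof (rule ccontr)
    assume "\<not> (\<exists>k\<le>m. (u, v) \<in> edges G ^^ k)"
    then have "enat (Suc m) \<le> gdist G u v"
      unfolding gdist_def by (intro INF_greatest) (auto simp: not_less_eq_eq[symmetric])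
    then have "enat (Suc m) \<le> enat m" using le by (rule order.trans)
    then show False by simp
  qed
next
  assume "\<exists>k\<le>m. (u, v) \<in> edges G ^^ k"
  then obtain k where "k \<le> m" "(u, v) \<in> edges G ^^ k" by blast
  then have "gdist G u v \<le> enat k" unfolding gdist_def by (intro INF_lower) simp
  also have "\<dots> \<le> enat m" using \<open>k \<le> m\<close> by simp
  finally show "gdist G u v \<le> enat m" .
qed

abbreviation path_cycle :: "nat \<Rightarrow> nat \<Rightarrow> (nat \<times> nat) graph" where
  "path_cycle m n \<equiv> cart_prod (path_graph m) (cycle_graph n)"

lemma verts_path_cycle: "verts (path_cycle m n) = {0..<m} \<times> {0..<n}"
  by (simp add: verts_def cart_prod_def path_graph_def cycle_graph_def)

lemma edges_path_cycle_iff: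
  "((i, x), (j, y)) \<in> edges (path_cycle m n) \<longleftrightarrow>
     i < m \<and> j < m \<and> x < n \<and> y < n \<and>
     ((j = i + 1 \<or> i = j + 1) \<and> x = y \<or> i = j \<and> (y = (x + 1) mod n \<or> x = (y + 1) mod n))"
  by (auto simp: verts_def edges_def cart_prod_def path_graph_def cycle_graph_def)

text \<open>Unroll the cycle to the integers: \<open>t\<close> is the net signed column displacement
  from \<open>y\<close> to \<open>x\<close>, with windings counted. Each edge changes either the row
  or \<open>t\<close> by one.\<close>

lemma walk_displacement:
  assumes "((i, x), (j, y)) \<in> edges (path_cycle m n) ^^ k"
  shows "\<exists>t. \<bar>int i - int j\<bar> + \<bar>t\<bar> \<le> int k \<and> int n dvd int x - int y - t"
  using assms
proof (induction k arbitrary: j y)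
  case 0
  then show ?case by (intro exI[of _ 0]) simp
next
  case (Suc k)
  then obtain j' y' where walk: "((i, x), (j', y')) \<in> edges (path_cycle m n) ^^ k"
    and edge: "((j', y'), (j, y)) \<in> edges (path_cycle m n)"
    by auto
  from Suc.IH[OF walk] obtain t where
    t: "\<bar>int i - int j'\<bar> + \<bar>t\<bar> \<le> int k" "int n dvd int x - int y' - t" by blast
  from edge consider "j = j' + 1 \<or> j' = j + 1" "y = y'"
    | "j = j'" "y = (y' + 1) mod n" | "j = j'" "y' = (y + 1) mod n"
    by (auto simp: edges_path_cycle_iff)
  then show ?case
  proof cases
    case 1
    with t show ?thesis by (intro exI[of _ t]) auto
  next
    case 2
    have "int n dvd int y' + 1 - int y"
      unfolding 2 using dvd_minus_mod[of "int n"] by (simp add: of_nat_mod add.commute)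
    with t(2) have "int n dvd (int x - int y' - t) + (int y' + 1 - int y)" by (rule dvd_add)
    with 2 t(1) show ?thesis by (intro exI[of _ "t - 1"]) (auto simp: algebra_simps)
  next
    case 3
    have "int n dvd int y + 1 - int y'"
      unfolding 3 using dvd_minus_mod[of "int n"] by (simp add: of_nat_mod add.commute)
    with t(2) have "int n dvd (int x - int y' - t) - (int y + 1 - int y')" by (rule dvd_diff)
    with 3 t(1) show ?thesis by (intro exI[of _ "t + 1"]) (auto simp: algebra_simps)
  qed
qed

lemma sym_relpow_path_cycle:
  "(u, v) \<in> edges (path_cycle m n) ^^ k \<Longrightarrow> (v, u) \<in> edges (path_cycle m n) ^^ k"
proof (induction k arbitrary: v)
  case (Suc k)
  then obtain w where "(u, w) \<in> edges (path_cycle m n) ^^ k" "(w, v) \<in> edges (path_cycle m n)"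
    by auto
  moreover from this have "(v, w) \<in> edges (path_cycle m n)"
    by (cases v; cases w) (auto simp: edges_path_cycle_iff)
  ultimately show ?case using Suc.IH relpow_Suc_I2 by metis
qed simp

definition absdiff :: "nat \<Rightarrow> nat \<Rightarrow> nat" where
  "absdiff a b = (a - b) + (b - a)"

lemma walk_row:
  assumes "i < m" "n > 0"
  shows "((i, x mod n), (i, y mod n)) \<in> edges (path_cycle m n) ^^ absdiff x y"
proof -
  have step: "((i, x mod n), (i, (x + d) mod n)) \<in> edges (path_cycle m n) ^^ d" for x d
  proof (induction d)
    case (Suc d)
    moreover have "((i, (x + d) mod n), (i, (x + Suc d) mod n)) \<in> edges (path_cycle m n)"
      using assms by (simp add: edges_path_cycle_iff mod_Suc_eq)
    ultimately show ?case by auto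
  qed simp
  show ?thesis
  proof (cases "x \<le> y")
    case True
    then show ?thesis using step[of x "y - x"] by (simp add: absdiff_def)
  next
    case False
    then show ?thesis
      using step[of y "x - y", THEN sym_relpow_path_cycle] by (simp add: absdiff_def)
  qed
qed

lemma walk_column:
  assumes "i < m" "j < m" "x < n"
  shows "((i, x), (j, x)) \<in> edges (path_cycle m n) ^^ absdiff i j"
proof -
  have step: "i + d < m \<Longrightarrow> ((i, x), (i + d, x)) \<in> edges (path_cycle m n) ^^ d" for i d
  proof (induction d)
    case (Suc d)
    moreover from Suc.prems have "((i + d, x), (i + Suc d, x)) \<in> edges (path_cycle m n)"
      using assms by (simp add: edges_path_cycle_iff)
    ultimately show ?case by auto
  qed simp
  show ?thesis
  proof (cases "i \<le> j")
    case True
    then show ?thesis using step[of i "j - i"] assms by (simp add: absdiff_def)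
  next
    case False
    then show ?thesis
      using step[of j "i - j", THEN sym_relpow_path_cycle] assms by (simp add: absdiff_def)
  qed
qed

text \<open>Go along the column, then along the row. Columns are unreduced representatives, so that
  \<open>y = n\<close> expresses the step from column \<open>n - 1\<close> back to column 0.\<close>

lemma gdist_path_cycle_le:
  assumes "i < m" "j < m" "n > 0"
  shows "gdist (path_cycle m n) (i, x mod n) (j, y mod n) \<le> enat (absdiff i j + absdiff x y)"
proof -
  have "((i, x mod n), (j, y mod n)) \<in> edges (path_cycle m n) ^^ (absdiff i j + absdiff x y)"
    using walk_column[of i m j "x mod n" n] walk_row[of j m n x y] assms
    by (auto simp: relpow_add)
  then show ?thesis by (auto simp: gdist_le_enat_iff)
qed

section \<open>The lower bound\<close>

text \<open>Size of the intersection of row \<open>i\<close> with a ball of radius \<open>s\<close>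
  around a vertex of row \<open>j\<close>, if nothing wraps around. Strength 0 is set apart because
  such a vertex does not even reach itself.\<close>

definition row_reach :: "nat \<Rightarrow> nat \<Rightarrow> nat \<Rightarrow> nat" where
  "row_reach i j s = (if s = 0 \<or> s < absdiff i j then 0 else 2 * (s - absdiff i j) + 1)"

text \<open>Every listening column is \<open>y + t\<close> modulo \<open>n\<close> with
  \<open>t\<close> in an interval of \<open>2 * (s - d) + 1\<close> integers. Wrapping around can
  only merge columns, so the bound holds for every \<open>n\<close>.\<close>

lemma card_hears_row_le:
  "card {x. x < n \<and> hears (path_cycle m n) f (i, x) (j, y)} \<le> row_reach i j (f (j, y))"
proof -
  define s where "s = f (j, y)"
  define d where "d = absdiff i j"
  let ?H = "{x. x < n \<and> hears (path_cycle m n) f (i, x) (j, y)}"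
  have *: "0 < s \<and> d \<le> s \<and> x \<in> (\<lambda>t. nat ((int y + t) mod int n)) ` {- int (s - d)..int (s - d)}"
    if "x \<in> ?H" for x
  proof -
    from that have x: "x < n" "s > 0" "gdist (path_cycle m n) (i, x) (j, y) \<le> enat s"
      by (auto simp: hears_def s_def)
    from x(3) obtain k where "k \<le> s" "((i, x), (j, y)) \<in> edges (path_cycle m n) ^^ k"
      by (auto simp: gdist_le_enat_iff)
    with walk_displacement[OF this(2)] obtain t where
      t: "\<bar>int i - int j\<bar> + \<bar>t\<bar> \<le> int s" "int n dvd int x - int y - t"
      by (meson of_nat_mono order.trans)
    have d: "int d = \<bar>int i - int j\<bar>" by (simp add: d_def absdiff_def)
    have "int x mod int n = (int y + t) mod int n"
      using t(2) by (simp add: mod_eq_dvd_iff algebra_simps)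
    with x(1) have "x = nat ((int y + t) mod int n)" by simp
    moreover have "d \<le> s" "t \<in> {- int (s - d)..int (s - d)}" using t(1) d by auto
    ultimately show ?thesis using x(2) by blast
  qed
  show ?thesis
  proof (cases "?H = {}")
    case False
    with * have sd: "0 < s" "d \<le> s" by blast+
    have "card ?H \<le> card ((\<lambda>t. nat ((int y + t) mod int n)) ` {- int (s - d)..int (s - d)})"
      using * by (intro card_mono) auto
    also have "\<dots> \<le> card {- int (s - d)..int (s - d)}" by (intro card_image_le) simp
    also have "\<dots> = 2 * (s - d) + 1" by simp
    finally show ?thesis using sd by (simp add: row_reach_def flip: s_def d_def)
  qed (simp only: card.empty)
qed

lemma row_coverage:
  assumes dom: "dominating_broadcast (path_cycle m n) f" and "i < m"
  shows "n \<le> (\<Sum>j<m. \<Sum>y<n. row_reach i j (f (j, y)))"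
proof -
  let ?H = "\<lambda>v. {x. x < n \<and> hears (path_cycle m n) f (i, x) v}"
  have "{..<n} \<subseteq> (\<Union>v \<in> {..<m} \<times> {..<n}. ?H v)"
    using dom \<open>i < m\<close> by (fastforce simp: dominating_broadcast_def verts_path_cycle)
  then have "card {..<n} \<le> card (\<Union>v \<in> {..<m} \<times> {..<n}. ?H v)"
    by (intro card_mono) auto
  also have "\<dots> \<le> (\<Sum>v \<in> {..<m} \<times> {..<n}. card (?H v))" by (intro card_UN_le) simp
  also have "\<dots> \<le> (\<Sum>v \<in> {..<m} \<times> {..<n}. row_reach i (fst v) (f v))"
    by (intro sum_mono) (auto intro: card_hears_row_le)
  also have "\<dots> = (\<Sum>j<m. \<Sum>y<n. row_reach i j (f (j, y)))"
    by (simp add: sum.cartesian_product case_prod_beta)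
  finally show ?thesis by simp
qed

text \<open>Here \<open>a\<^sub>i\<close> and \<open>b\<^sub>i\<close> count the vertices of strength 2 and 1 in row \<open>i\<close>.\<close>

lemma row_count_arith:
  fixes a0 a1 a2 a3 b0 b1 b2 b3 n :: nat
  assumes r0: "n \<le> 5*a0 + 3*a1 + a2 + 3*b0 + b1"
    and r1: "n \<le> 3*a0 + 5*a1 + 3*a2 + a3 + b0 + 3*b1 + b2"
    and r2: "n \<le> a0 + 3*a1 + 5*a2 + 3*a3 + b1 + 3*b2 + b3"
    and r3: "n \<le> a1 + 3*a2 + 5*a3 + b2 + 3*b3"
  shows "8 * (n div 10) + c_tab (n mod 10) \<le> 2*(a0 + a1 + a2 + a3) + (b0 + b1 + b2 + b3)"
proof -
  define c where "c = 2*(a0 + a1 + a2 + a3) + (b0 + b1 + b2 + b3)"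
  define k r where "k = n div 10" and "r = n mod 10"
  have n: "n = 10 * k + r" "r < 10" by (auto simp: k_def r_def)
  obtain s0 where s0: "5*a0 + 3*a1 + a2 + 3*b0 + b1 = n + s0" using r0 le_Suc_ex by blast
  obtain s1 where s1: "3*a0 + 5*a1 + 3*a2 + a3 + b0 + 3*b1 + b2 = n + s1"
    using r1 le_Suc_ex by blast
  obtain s2 where s2: "a0 + 3*a1 + 5*a2 + 3*a3 + b1 + 3*b2 + b3 = n + s2"
    using r2 le_Suc_ex by blast
  obtain s3 where s3: "a1 + 3*a2 + 5*a3 + b2 + 3*b3 = n + s3" using r3 le_Suc_ex by blast
  \<comment> \<open>The weights 3, 1, 1, 3 on the four rows. All extra terms are nonnegative losses;
    strength 2 in an inner row and strength 1 in an outer row lose nothing.\<close>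
  have slack: "10 * c = 8 * n + a0 + a3 + 3*b1 + 3*b2 + 3*s0 + s1 + s2 + 3*s3"
    using s0 s1 s2 s3 by (simp add: c_def)
  have "8 * k + c_tab r \<le> c"
  proof (rule ccontr)
    assume less: "\<not> ?thesis"
    from n(2) consider "r \<in> {0,2,3,4,6,7,8,9}" | "r = 5" | "r = 1" by force
    then show False
    proof cases
      case 1
      \<comment> \<open>For these residues the table value is exactly 4r/5 rounded up.\<close>
      with less slack n(1) show False by (auto simp: c_tab_def)
    next
      case 2
      with less have "c \<le> 8 * k + 4" by (simp add: c_tab_def)
      \<comment> \<open>Now \<open>10 * c\<close> is at most \<open>8 * n\<close>, so every loss
        vanishes.\<close>
      with slack n 2 have "a0 = 0" "a3 = 0" "b1 = 0" "b2 = 0" "s0 = 0" "s1 = 0" "s2 = 0" "s3 = 0"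
        by linarith+
      with s0 s1 s2 s3 have "a1 = a2" "n = 10 * a1" by linarith+
      with n(1) 2 show False by presburger
    next
      case 3
      with less have "c \<le> 8 * k + 1" by (simp add: c_tab_def)
      moreover from slack n 3 have "80 * k + 8 \<le> 10 * c" by linarith
      ultimately have "c = 8 * k + 1" by presburger
      with slack n 3 have tot: "a0 + a3 + 3*b1 + 3*b2 + 3*s0 + s1 + s2 + 3*s3 = 2" by linarith
      then have z: "b1 = 0" "b2 = 0" "s0 = 0" "s3 = 0" by linarith+
      \<comment> \<open>Three times row 1 minus row 0 eliminates \<open>b0\<close>.\<close>
      have "12*a1 + 8*a2 + 4*a0 + 3*a3 = 2 * n + 3*s1" using s0 s1 z by linarith
      then have rows01: "12*a1 + 8*a2 + 4*a0 + 3*a3 = 20 * k + 2 + 3*s1" using n(1) 3 by simp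
      \<comment> \<open>Subtract from this equation its mirror image for rows 2 and 3.\<close>
      have diff: "4*a1 + a0 + 3*s2 = 4*a2 + a3 + 3*s1" using s0 s1 s2 s3 z by linarith
      \<comment> \<open>By parity, the remaining loss of 2 lies entirely in \<open>a3 + s1\<close>
        or entirely in \<open>a0 + s2\<close>. In both cases \<open>rows01\<close> finally equates
        an odd number with \<open>2*k\<close>.\<close>
      have "even (a3 + s1)" using arg_cong[OF rows01, of even] by simp
      moreover have sum2: "a0 + s2 + (a3 + s1) = 2" using tot z by simp
      ultimately consider "a3 + s1 = 0" | "a3 + s1 = 2" by fastforce
      then show False
      proof cases
        case 1
        with diff sum2 have "2*a1 + 1 + s2 = 2*a2" by linarith
        then have "odd s2" by presburger
        with sum2 have "s2 = 1" by (cases s2 rule: nat.exhaust) auto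
        with 1 diff sum2 have "a2 = a1 + 1" "a0 = 1" by linarith+
        with 1 rows01 have "2*a1 + 1 = 2*k" by simp
        then show False by presburger
      next
        case 2
        with diff sum2 have "2*a1 = 2*a2 + 1 + s1" by linarith
        then have "odd s1" by presburger
        with sum2 have "s1 = 1" by (cases s1 rule: nat.exhaust) auto
        with 2 diff sum2 have "a1 = a2 + 1" "a3 = 1" "a0 = 0" by linarith+
        with \<open>s1 = 1\<close> rows01 have "2*a2 + 1 = 2*k" by simp
        then show False by presburger
      qed
    qed
  qed
  then show ?thesis by (simp add: c_def k_def r_def)
qed

lemma broadcast_cost_ge:
  assumes bc: "limited_broadcast2 (path_cycle 4 n) f"
    and dom: "dominating_broadcast (path_cycle 4 n) f"
  shows "8 * (n div 10) + c_tab (n mod 10) \<le> broadcast_cost (path_cycle 4 n) f"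
proof -
  define A where "A j = (\<Sum>y<n. of_bool (f (j, y) = 2) :: nat)" for j
  define B where "B j = (\<Sum>y<n. of_bool (f (j, y) = 1) :: nat)" for j
  have le2: "f (j, y) \<le> 2" if "j < 4" "y < n" for j y
    using bc that by (simp add: limited_broadcast2_def verts_path_cycle)
  \<comment> \<open>Used with the identity for the cost and with \<open>row_reach i j\<close> for
    the coverage.\<close>
  have split: "(\<Sum>y<n. g (f (j, y))) = A j * g 2 + B j * g 1"
    if "j < 4" "g 0 = 0" for j and g :: "nat \<Rightarrow> nat"
  proof -
    have "g (f (j, y)) = of_bool (f (j, y) = 2) * g 2 + of_bool (f (j, y) = 1) * g 1"
      if "y < n" for y
    proof -
      have "f (j, y) = 0 \<or> f (j, y) = 1 \<or> f (j, y) = 2"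
        using le2[OF \<open>j < 4\<close> that] by linarith
      with \<open>g 0 = 0\<close> show ?thesis by auto
    qed
    then show ?thesis by (simp add: A_def B_def sum.distrib sum_distrib_right)
  qed
  have "broadcast_cost (path_cycle 4 n) f = (\<Sum>j<4. \<Sum>y<n. f (j, y))"
    by (simp add: broadcast_cost_def verts_path_cycle sum.cartesian_product
        flip: atLeast0LessThan)
  also have "\<dots> = (\<Sum>j<4. A j * 2 + B j * 1)"
    using split[of _ "\<lambda>s. s"] by simp
  also have "\<dots> = 2 * (A 0 + A 1 + A 2 + A 3) + (B 0 + B 1 + B 2 + B 3)"
    by (simp add: eval_nat_numeral)
  finally have cost: "broadcast_cost (path_cycle 4 n) f =
    2 * (A 0 + A 1 + A 2 + A 3) + (B 0 + B 1 + B 2 + B 3)" .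
  have rows: "n \<le> (\<Sum>j<4. A j * row_reach i j 2 + B j * row_reach i j 1)" if "i < 4" for i
  proof -
    have "(\<Sum>j<4. \<Sum>y<n. row_reach i j (f (j, y))) =
        (\<Sum>j<4. A j * row_reach i j 2 + B j * row_reach i j 1)"
      by (intro sum.cong refl split) (auto simp: row_reach_def)
    with row_coverage[OF dom that] show ?thesis by simp
  qed
  have four: "{..<4} = {0, 1, 2, 3::nat}" by auto
  note expand = four row_reach_def absdiff_def
  show ?thesis unfolding cost
    by (rule row_count_arith) (use rows[of 0] rows[of 1] rows[of 2] rows[of 3] in \<open>simp_all add: expand\<close>)
qed

section \<open>The upper bound\<close>

text \<open>A word is a list of columns, each the list of the four broadcast strengths in it. The column
  appended in the definition of a tile is the first column of whatever tile comes next.\<close>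

definition start_column :: "nat list" where
  "start_column = [0, 2, 0, 0]"

definition covers :: "nat list list \<Rightarrow> nat \<Rightarrow> nat \<Rightarrow> nat \<Rightarrow> nat \<Rightarrow> bool" where
  "covers W i x j y \<longleftrightarrow> 0 < W ! y ! j \<and> absdiff i j + absdiff x y \<le> W ! y ! j"

text \<open>The first condition is put on the extended word so that the empty word is a tile. All
  quantifiers are bounded, so concrete words can be checked by evaluation.\<close>

definition tile :: "nat list list \<Rightarrow> bool" where
  "tile W \<longleftrightarrow> (W @ [start_column]) ! 0 = start_column \<and>
     list_all (\<lambda>c. length c = 4 \<and> list_all (\<lambda>s. s \<le> 2) c) W \<and>
     (\<forall>i<4. \<forall>x<length W. \<exists>j<4. \<exists>y<Suc (length W). covers (W @ [start_column]) i x j y)"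

lemma tile_append:
  assumes U: "tile U" and V: "tile V"
  shows "tile (U @ V)"
proof -
  let ?s = "[start_column]"
  have hdV: "(V @ ?s) ! 0 = start_column" using V by (simp add: tile_def)
  have first: "((U @ V) @ ?s) ! 0 = start_column"
    using U hdV by (cases U) (auto simp: tile_def)
  \<comment> \<open>At \<open>y = length U\<close> this is where it matters that \<open>V\<close>
    begins with \<open>start_column\<close>; for empty \<open>V\<close> the appended column takes
    over.\<close>
  have U_nth: "((U @ V) @ ?s) ! y = (U @ ?s) ! y" if "y \<le> length U" for y
    using that hdV by (cases "y = length U") (auto simp: nth_append)
  have V_nth: "((U @ V) @ ?s) ! (length U + y) = (V @ ?s) ! y" for y
    by (simp add: nth_append)
  have "\<exists>j<4. \<exists>y<Suc (length (U @ V)). covers ((U @ V) @ ?s) i x j y"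
    if "i < 4" "x < length (U @ V)" for i x
  proof (cases "x < length U")
    case True
    with U \<open>i < 4\<close> obtain j y where "j < 4" "y < Suc (length U)" "covers (U @ ?s) i x j y"
      unfolding tile_def by blast
    then show ?thesis using U_nth[of y]
      by (intro exI[of _ j] conjI exI[of _ y]) (auto simp: covers_def)
  next
    case False
    then obtain x' where x': "x = length U + x'" using le_Suc_ex not_less by metis
    with that have "x' < length V" by simp
    with V \<open>i < 4\<close> obtain j y where "j < 4" "y < Suc (length V)" "covers (V @ ?s) i x' j y"
      unfolding tile_def by blast
    then show ?thesis using V_nth[of y] x'
      by (intro exI[of _ j] conjI exI[of _ "length U + y"]) (auto simp: covers_def absdiff_def)
  qed
  with first U V show ?thesis by (simp add: tile_def)
qed

definition tileable :: "nat \<Rightarrow> nat \<Rightarrow> bool" where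
  "tileable n c \<longleftrightarrow> (\<exists>W. tile W \<and> length W = n \<and> (\<Sum>c\<leftarrow>W. sum_list c) = c)"

lemma tileable_add: "tileable m c \<Longrightarrow> tileable n d \<Longrightarrow> tileable (m + n) (c + d)"
  unfolding tileable_def using tile_append by (metis length_append map_append sum_list_append)

lemma tileable_mult: "tileable m c \<Longrightarrow> tileable (k * m) (k * c)"
proof (induction k)
  case 0
  have "tile []" by (simp add: tile_def)
  then show ?case unfolding tileable_def by (intro exI[of _ "[]"]) simp
next
  case (Suc k)
  then show ?case using tileable_add[of m c "k * m" "k * c"] by simp
qed

lemma broadcast_of_tile:
  assumes W: "tile W" and n: "length W = n" "n > 0"
  defines "f \<equiv> \<lambda>(i, x). if i < 4 \<and> x < n then W ! x ! i else 0"
  shows "limited_broadcast2 (path_cycle 4 n) f" "dominating_broadcast (path_cycle 4 n) f"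
    "broadcast_cost (path_cycle 4 n) f = (\<Sum>c\<leftarrow>W. sum_list c)"
proof -
  have len: "length (W ! x) = 4" if "x < n" for x
    using W n that by (auto simp: tile_def list_all_length)
  show "limited_broadcast2 (path_cycle 4 n) f"
    using W n len
    by (auto simp: limited_broadcast2_def f_def verts_path_cycle tile_def list_all_length)
  have "broadcast_cost (path_cycle 4 n) f = (\<Sum>i<4. \<Sum>x<n. W ! x ! i)"
    by (simp add: broadcast_cost_def verts_path_cycle f_def atLeast0LessThan
        flip: sum.cartesian_product)
  also have "\<dots> = (\<Sum>x<n. \<Sum>i<4. W ! x ! i)" by (rule sum.swap)
  also have "\<dots> = (\<Sum>x<n. sum_list (W ! x))"
    using len by (simp add: sum_list_sum_nth atLeast0LessThan)
  also have "\<dots> = (\<Sum>c\<leftarrow>W. sum_list c)"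
    using n by (simp add: sum_list_sum_nth atLeast0LessThan)
  finally show "broadcast_cost (path_cycle 4 n) f = (\<Sum>c\<leftarrow>W. sum_list c)" .
  \<comment> \<open>Closing the word to a cycle identifies the appended column \<open>n\<close> with
    column 0, and both are \<open>start_column\<close>.\<close>
  have f_mod: "f (j, y mod n) = (W @ [start_column]) ! y ! j" if "j < 4" "y < Suc n" for j y
  proof (cases "y = n")
    case True
    then show ?thesis using W n that by (simp add: f_def tile_def nth_append)
  next
    case False
    then show ?thesis using n that by (simp add: f_def nth_append)
  qed
  show "dominating_broadcast (path_cycle 4 n) f"
    unfolding dominating_broadcast_def
  proof
    fix u assume "u \<in> verts (path_cycle 4 n)"
    then obtain i x where u: "u = (i, x)" "i < 4" "x < n" by (auto simp: verts_path_cycle)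
    with W n obtain j y where jy: "j < 4" "y < Suc n" "covers (W @ [start_column]) i x j y"
      unfolding tile_def by blast
    have "gdist (path_cycle 4 n) (i, x) (j, y mod n) \<le> enat (absdiff i j + absdiff x y)"
      using gdist_path_cycle_le[of i 4 j n x y] u jy n by simp
    also have "\<dots> \<le> enat (f (j, y mod n))" using jy f_mod by (simp add: covers_def)
    finally have "hears (path_cycle 4 n) f u (j, y mod n)"
      using jy f_mod u by (simp add: hears_def covers_def)
    moreover have "(j, y mod n) \<in> verts (path_cycle 4 n)"
      using jy n by (simp add: verts_path_cycle)
    ultimately show "\<exists>v\<in>verts (path_cycle 4 n). hears (path_cycle 4 n) f u v" by blast
  qed
qed

lemma tileable_1: "tileable 1 2"
  unfolding tileable_def
  by (rule exI[of _ "[[0,2,0,0]]"]) code_simp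

lemma tileable_3: "tileable 3 3"
  unfolding tileable_def
  by (rule exI[of _ "[[0,2,0,0], [0,0,0,1], [0,0,0,0]]"]) code_simp

lemma tileable_4: "tileable 4 4"
  unfolding tileable_def
  by (rule exI[of _ "[[0,2,0,0], [0,0,0,0], [0,0,2,0], [0,0,0,0]]"]) code_simp

lemma tileable_5: "tileable 5 5"
  unfolding tileable_def
  by (rule exI[of _ "[[0,2,0,0], [0,0,0,0], [1,0,0,2], [0,0,0,0], [0,0,0,0]]"]) code_simp

lemma tileable_6: "tileable 6 5"
  unfolding tileable_def
  by (rule exI[of _ "[[0,2,0,0], [0,0,0,0], [0,0,0,0], [1,0,0,2], [0,0,0,0], [0,0,0,0]]"]) code_simp

lemma tileable_7: "tileable 7 6"
  unfolding tileable_def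
  by (rule exI[of _ "[[0,2,0,0], [0,0,0,0], [0,0,0,1], [1,0,0,0], [0,0,0,0], [0,0,2,0],
      [0,0,0,0]]"]) code_simp

lemma tileable_8: "tileable 8 7"
  unfolding tileable_def
  by (rule exI[of _ "[[0,2,0,0], [0,0,0,0], [0,0,0,1], [0,0,0,0], [2,0,1,0], [0,0,0,0],
      [0,0,0,1], [0,0,0,0]]"]) code_simp

text \<open>The periodic block: strength 2 only in inner rows and strength 1 only in outer rows,
  with cost exactly 4/5 per column, the optimum of the weighted count.\<close>

lemma tileable_10: "tileable 10 8"
  unfolding tileable_def
  by (rule exI[of _ "[[0,2,0,0], [0,0,0,0], [0,0,0,1], [1,0,0,0], [0,0,0,0], [0,0,2,0],
      [0,0,0,0], [1,0,0,0], [0,0,0,1], [0,0,0,0]]"]) code_simp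

lemma tileable_formula:
  assumes "n \<ge> 3"
  shows "tileable n (8 * (n div 10) + c_tab (n mod 10))"
proof -
  define k r where "k = n div 10" and "r = n mod 10"
  have n: "n = k * 10 + r" "r < 10" by (auto simp: k_def r_def)
  have blocks: "tileable (k * 10 + m) (8 * k + c)" if "tileable m c" for k m c
    using tileable_add[OF tileable_mult[OF tileable_10] that] by (simp add: mult.commute)
  have "tileable n (8 * k + c_tab r)"
  proof (cases "r = 2")
    \<comment> \<open>No tile of length 2 has cost 2: after \<open>start_column\<close> the second
      column would be zero, leaving its bottom vertex uncovered. Instead two blocks of length 6
      replace one block of length 10 and the remainder: 12 columns at cost 8 + 2.\<close>
    case True
    with n assms obtain k' where k: "k = Suc k'" by (cases k) auto
    from blocks[OF tileable_add[OF tileable_6 tileable_6], of k'] show ?thesis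
      using True n k by (simp add: c_tab_def add.commute)
  next
    case False
    with n(2) have "r \<in> {0, 1, 3, 4, 5, 6, 7, 8, 9}" by auto
    \<comment> \<open>Zero copies of a block serve \<open>r = 0\<close>, and \<open>r = 9\<close> is
      6 + 3 at cost 5 + 3.\<close>
    then have "tileable r (c_tab r)"
      using tileable_mult[OF tileable_1, of 0] tileable_1 tileable_3 tileable_4 tileable_5
        tileable_6 tileable_7 tileable_8 tileable_add[OF tileable_6 tileable_3]
      by (elim insertE) (simp_all add: c_tab_def)
    from blocks[OF this] show ?thesis using n by simp
  qed
  then show ?thesis by (simp add: k_def r_def)
qed

theorem theorem4p9:
  fixes n :: nat
  assumes "n \<ge> 3"
  shows "gamma_b2 (cart_prod (path_graph 4) (cycle_graph n)) = 8 * (n div 10) + c_tab (n mod 10)"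
  unfolding gamma_b2_def
proof (rule Least_equality)
  obtain W where "tile W" "length W = n"
    "(\<Sum>c\<leftarrow>W. sum_list c) = 8 * (n div 10) + c_tab (n mod 10)"
    using tileable_formula[OF assms] unfolding tileable_def by blast
  with broadcast_of_tile[of W n] assms
  show "\<exists>f. limited_broadcast2 (path_cycle 4 n) f \<and> dominating_broadcast (path_cycle 4 n) f \<and>
      broadcast_cost (path_cycle 4 n) f = 8 * (n div 10) + c_tab (n mod 10)"
    by auto
qed (use broadcast_cost_ge in auto)

end
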